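(* For a positive integer $n$, let $\mathcal{Q}^+(n) = \{ \lfloor n/k \rfloor : 1 \le k \le \lfloor \sqrt{n} \rfloor \}$. For all integers $j,\ell$ with $1 \le j, \ell \le \lfloor \sqrt{n} \rfloor$ we have $$\left\lfloor \frac{n}{j} \right\rfloor \preccurlyeq_1 \left\lfloor \frac{n}{\ell} \right\rfloor \quad\text{if and only if}\quad \ell \mid j.$$ That is, the map $k \mapsto \lfloor n/k \rfloor$ defines an anti-isomorphism of posets (an order-reversing bijection whose inverse is also order-reversing) from the set $\{1,2,\ldots,\lfloor \sqrt{n}\rfloor\}$ equipped with the divisibility order to $\mathcal{Q}^+(n)$ with the floor quotient order.
   Context: For positive integers $d,n$, $d$ is a floor quotient of $n$, written $d \preccurlyeq_1 n$, if $d = \lfloor n/k \rfloor$ for some positive integer $k$. The floor quotient order on a set of positive integers is the relation $\preccurlyeq_1$ restricted to that set; it is a partial order. *)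

theory Defs
  imports Complex_Main
begin

text \<open>
  On natural numbers \<open>n div k\<close> is the floor of \<open>n / k\<close>. The relation lives on positive integers,
  so \<open>0 = n div k\<close> (for \<open>k > n\<close>) is not a floor quotient.
\<close>

definition floor_quotient :: "nat \<Rightarrow> nat \<Rightarrow> bool"  (infix "\<preceq>\<^sub>1" 50) where
  "d \<preceq>\<^sub>1 n \<longleftrightarrow> 0 < d \<and> 0 < n \<and> (\<exists>k>0. d = n div k)"

definition Q_plus :: "nat \<Rightarrow> nat set" where
  "Q_plus n = {n div k | k. 1 \<le> k \<and> k \<le> nat \<lfloor>sqrt (real n)\<rfloor>}"

definition poset_on :: "'a set \<Rightarrow> ('a \<Rightarrow> 'a \<Rightarrow> bool) \<Rightarrow> bool" where
  "poset_on A r \<longleftrightarrow> reflp_on A r \<and> antisymp_on A r \<and> transp_on A r"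

definition poset_anti_iso ::
  "'a set \<Rightarrow> ('a \<Rightarrow> 'a \<Rightarrow> bool) \<Rightarrow> 'b set \<Rightarrow> ('b \<Rightarrow> 'b \<Rightarrow> bool) \<Rightarrow> ('a \<Rightarrow> 'b) \<Rightarrow> bool" where
  "poset_anti_iso A r B s f \<longleftrightarrow>
     poset_on A r \<and> poset_on B s \<and> bij_betw f A B \<and>
     monotone_on A r (\<lambda>x y. s y x) f \<and>
     monotone_on B s (\<lambda>x y. r y x) (inv_into A f)"

end

theory Submission
  imports Defs
begin

text \<open>
  Since \<open>(n div l) div k = n div (l * k)\<close>, the floor quotients of \<open>n div l\<close> are the positive
  numbers \<open>n div m\<close> with \<open>m\<close> a multiple of \<open>l\<close>. So \<open>l dvd j\<close> always makes \<open>n div j\<close> a floor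
  quotient of \<open>n div l\<close>, as long as both are positive. The converse needs that \<open>n div j\<close>
  determines \<open>j\<close>, and this is where the bound \<open>j\<^sup>2 \<le> n\<close> enters: up to \<open>\<surd>n\<close> consecutive
  quotients differ, and no larger denominator repeats one of them
  (\<open>denominator_unique_below_sqrt\<close>). It is essential that only \<open>j\<close> is bounded there, because the
  multiple \<open>l * k\<close> to be compared with \<open>j\<close> may a priori exceed \<open>\<surd>n\<close>.
  The resulting equivalence \<open>floor_quotient_iff_dvd\<close>, together with the same uniqueness of
  denominators, says that \<open>k \<mapsto> n div k\<close> is an order-reversing bijection with
  order-reversing inverse.
\<close>

lemma le_floor_sqrt_iff: "j \<le> nat \<lfloor>sqrt (real n)\<rfloor> \<longleftrightarrow> j\<^sup>2 \<le> n"
proof -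
  have "j \<le> nat \<lfloor>sqrt (real n)\<rfloor> \<longleftrightarrow> real j \<le> sqrt (real n)"
    by (simp add: le_nat_iff le_floor_iff)
  also have "\<dots> \<longleftrightarrow> (real j)\<^sup>2 \<le> real n"
  proof
    assume "real j \<le> sqrt (real n)"
    then have "(real j)\<^sup>2 \<le> (sqrt (real n))\<^sup>2"
      by (rule power_mono) simp
    then show "(real j)\<^sup>2 \<le> real n" by simp
  qed (rule real_le_rsqrt)
  also have "\<dots> \<longleftrightarrow> j\<^sup>2 \<le> n"
    by (metis of_nat_le_iff of_nat_power)
  finally show ?thesis .
qed

text \<open>
  The common quotient \<open>q\<close> is at least \<open>j\<close>. The numbers with quotient \<open>q\<close> by \<open>i\<close> form the interval
  \<open>{i * q..<i * q + i}\<close> of length \<open>i\<close>, and raising \<open>i\<close> by one moves its left endpoint by \<open>q\<close>.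
  As long as \<open>i \<le> j \<le> q\<close>, the interval therefore ends before those of all larger denominators
  begin, so the interval of \<open>j\<close> is disjoint from that of every \<open>m \<noteq> j\<close>.
\<close>

lemma denominator_unique_below_sqrt:
  fixes j m n :: nat
  assumes "0 < j" "j\<^sup>2 \<le> n" "n div m = n div j"
  shows "m = j"
proof -
  define q where "q = n div j"
  have "j \<le> q"
    using assms(1,2) by (simp add: q_def less_eq_div_iff_mult_less_eq power2_eq_square)
  \<comment> \<open>This excludes \<open>m = 0\<close>, where the convention \<open>n div 0 = 0\<close> would contradict \<open>q > 0\<close>.\<close>
  have "0 < m"
    using assms \<open>j \<le> q\<close> by (intro gr0I) (simp add: q_def)
  have j_bounds: "j * q \<le> n" "n < j * q + j"
    using dividend_less_times_div[OF \<open>0 < j\<close>, of n] by (simp_all add: q_def)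
  have m_bounds: "m * q \<le> n" "n < m * q + m"
    using dividend_less_times_div[OF \<open>0 < m\<close>, of n] times_div_less_eq_dividend[of m n]
    by (simp_all add: q_def assms(3))
  show "m = j"
  proof (rule linorder_cases[of m j])
    assume "m < j"
    then have "m * q + q \<le> j * q"
      by (metis Suc_leI add.commute mult_Suc mult_le_mono1)
    then show ?thesis
      using \<open>m < j\<close> \<open>j \<le> q\<close> j_bounds m_bounds by linarith
  next
    assume "j < m"
    then have "j * q + q \<le> m * q"
      by (metis Suc_leI add.commute mult_Suc mult_le_mono1)
    then show ?thesis
      using \<open>j \<le> q\<close> j_bounds m_bounds by linarith
  qed
qed

lemma div_pos_below_sqrt:
  fixes j n :: nat
  assumes "0 < j" "j\<^sup>2 \<le> n"
  shows "0 < n div j"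
proof -
  have "j * 1 \<le> j\<^sup>2"
    unfolding power2_eq_square using assms(1) by (intro mult_le_mono2) simp
  then show ?thesis
    using assms by (simp add: div_greater_zero_iff)
qed

lemma floor_quotient_iff_dvd:
  assumes "0 < j" "j\<^sup>2 \<le> n" "0 < l" "l\<^sup>2 \<le> n"
  shows "n div j \<preceq>\<^sub>1 n div l \<longleftrightarrow> l dvd j"
proof
  assume "n div j \<preceq>\<^sub>1 n div l"
  then obtain k where "n div j = n div l div k"
    unfolding floor_quotient_def by blast
  then have "n div (l * k) = n div j"
    by (simp add: div_mult2_eq)
  then have "l * k = j"
    using assms denominator_unique_below_sqrt by blast
  then show "l dvd j" by auto
next
  assume "l dvd j"
  then obtain k where "j = l * k" by blast
  then show "n div j \<preceq>\<^sub>1 n div l"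
    unfolding floor_quotient_def
    using assms div_pos_below_sqrt[of j n] div_pos_below_sqrt[of l n]
    by (auto simp: div_mult2_eq)
qed

lemma floor_quotient_refl: "0 < d \<Longrightarrow> d \<preceq>\<^sub>1 d"
  unfolding floor_quotient_def by (metis div_by_1 zero_less_one)

lemma floor_quotient_imp_le: "d \<preceq>\<^sub>1 e \<Longrightarrow> d \<le> e"
  unfolding floor_quotient_def by auto

lemma floor_quotient_trans: "c \<preceq>\<^sub>1 d \<Longrightarrow> d \<preceq>\<^sub>1 e \<Longrightarrow> c \<preceq>\<^sub>1 e"
  unfolding floor_quotient_def by (metis div_mult2_eq nat_0_less_mult_iff)

lemma poset_on_floor_quotient:
  assumes "\<And>d. d \<in> A \<Longrightarrow> 0 < d"
  shows "poset_on A (\<preceq>\<^sub>1)"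
  unfolding poset_on_def
proof (intro conjI)
  show "reflp_on A (\<preceq>\<^sub>1)"
    using assms floor_quotient_refl by (blast intro: reflp_onI)
  show "antisymp_on A (\<preceq>\<^sub>1)"
    by (intro antisymp_onI le_antisym floor_quotient_imp_le)
  show "transp_on A (\<preceq>\<^sub>1)"
    by (intro transp_onI) (rule floor_quotient_trans)
qed

lemma poset_on_dvd: "poset_on (A :: nat set) (dvd)"
  unfolding poset_on_def
  by (auto intro!: reflp_onI antisymp_onI transp_onI intro: dvd_antisym dvd_trans)

text \<open>
  A bijection that reflects as well as reverses the order has an order-reversing inverse, so both
  monotonicity requirements reduce to a single equivalence.
\<close>

lemma poset_anti_isoI:
  assumes "poset_on A r" "poset_on B s" and bij: "bij_betw f A B"
    and iff: "\<And>x y. x \<in> A \<Longrightarrow> y \<in> A \<Longrightarrow> s (f y) (f x) \<longleftrightarrow> r x y"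
  shows "poset_anti_iso A r B s f"
proof -
  have "monotone_on B s (\<lambda>x y. r y x) (inv_into A f)"
  proof (rule monotone_onI)
    fix u v assume uv: "u \<in> B" "v \<in> B" "s u v"
    have "inv_into A f u \<in> A" "inv_into A f v \<in> A"
      using uv bij by (metis bij_betw_imp_surj_on inv_into_into)+
    moreover have "f (inv_into A f u) = u" "f (inv_into A f v) = v"
      using uv bij by (simp_all add: bij_betw_inv_into_right)
    ultimately show "r (inv_into A f v) (inv_into A f u)"
      using iff[of "inv_into A f v" "inv_into A f u"] uv(3) by simp
  qed
  moreover have "monotone_on A r (\<lambda>x y. s y x) f"
    by (rule monotone_onI) (simp add: iff)
  ultimately show ?thesis
    using assms unfolding poset_anti_iso_def by simp
qed

theorem theorem1p3:
  fixes n :: nat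
  assumes "n > 0"
  shows "(\<forall>j l. 1 \<le> j \<and> j \<le> nat \<lfloor>sqrt (real n)\<rfloor> \<and> 1 \<le> l \<and> l \<le> nat \<lfloor>sqrt (real n)\<rfloor> \<longrightarrow>
            (n div j \<preceq>\<^sub>1 n div l \<longleftrightarrow> l dvd j)) \<and>
         poset_anti_iso {1..nat \<lfloor>sqrt (real n)\<rfloor>} (dvd) (Q_plus n) (\<preceq>\<^sub>1) (\<lambda>k. n div k)"
proof
  let ?A = "{1..nat \<lfloor>sqrt (real n)\<rfloor>}"
  have mem_iff: "k \<in> ?A \<longleftrightarrow> 0 < k \<and> k\<^sup>2 \<le> n" for k
    using le_floor_sqrt_iff[of k n] by auto
  have order_iff: "n div j \<preceq>\<^sub>1 n div l \<longleftrightarrow> l dvd j" if "j \<in> ?A" "l \<in> ?A" for j l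
    using that floor_quotient_iff_dvd unfolding mem_iff by blast
  then show "\<forall>j l. 1 \<le> j \<and> j \<le> nat \<lfloor>sqrt (real n)\<rfloor> \<and> 1 \<le> l \<and> l \<le> nat \<lfloor>sqrt (real n)\<rfloor> \<longrightarrow>
      (n div j \<preceq>\<^sub>1 n div l \<longleftrightarrow> l dvd j)"
    by simp
  have Q_plus_image: "Q_plus n = (\<lambda>k. n div k) ` ?A"
    unfolding Q_plus_def by auto
  show "poset_anti_iso ?A (dvd) (Q_plus n) (\<preceq>\<^sub>1) (\<lambda>k. n div k)"
  proof (rule poset_anti_isoI)
    show "poset_on ?A (dvd)"
      by (rule poset_on_dvd)
    show "poset_on (Q_plus n) (\<preceq>\<^sub>1)"
    proof (rule poset_on_floor_quotient)
      fix d assume "d \<in> Q_plus n"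
      then obtain k where "k \<in> ?A" "d = n div k"
        unfolding Q_plus_image by blast
      then show "0 < d"
        using div_pos_below_sqrt mem_iff by blast
    qed
    have "inj_on (\<lambda>k. n div k) ?A"
    proof (rule inj_onI)
      fix x y assume "x \<in> ?A" "y \<in> ?A" "n div x = n div y"
      then show "x = y"
        using denominator_unique_below_sqrt[of y n x] mem_iff[of y] by blast
    qed
    then show "bij_betw (\<lambda>k. n div k) ?A (Q_plus n)"
      unfolding Q_plus_image by (rule inj_on_imp_bij_betw)
    show "n div y \<preceq>\<^sub>1 n div x \<longleftrightarrow> x dvd y" if "x \<in> ?A" "y \<in> ?A" for x y
      using order_iff that by blast
  qed
qed

end
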